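(* Let $n\geq 5$ be odd, let $C_{2n}$ be the cycle with nodes $v_0,\dots,v_{2n-1}$ and edges $j=v_jv_{(j+1)\bmod 2n}$ for $0\leq j<2n$ (edge indices taken modulo $2n$), and let $S=\{\{v_i,v_{(i+n)\bmod 2n}\}:1\leq i\leq n\}$. Then for $\beta\in\{1,2\}$ and $\beta'=3-\beta$, the inequality $$\sum_{i=0}^{n-1}(\beta x_{2i-1}+\beta' x_{2i})\geq 3$$ defines a shared facet of $\mathrm{MultC}(C_{2n},S)$.
   Context: Given a graph $G=(V,E)$ and $S\subseteq\binom{V}{2}$, an ($S$-)multicut is a set $\delta\subseteq E$ such that for every $\{s,t\}\in S$ the nodes $s$ and $t$ lie in different components of $G-\delta$. For $F\subseteq E$, $x^F\in\mathbb{R}^E$ is its incidence vector. The multicut polytope is $\mathrm{MultC}^{\square}(G,S)=\mathrm{conv}\{x^\delta:\delta\text{ an } S\text{-multicut}\}$ and the multicut dominant is $\mathrm{MultC}(G,S)=\mathrm{MultC}^{\square}(G,S)+\mathbb{R}^E_{\geq 0}$. A facet-defining inequality of $\mathrm{MultC}(G,S)$ defines a shared facet if it is also facet-defining for $\mathrm{MultC}^{\square}(G,S)$. *)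

theory Defs
  imports "HOL-Analysis.Analysis"
begin

text \<open>
  Graphs are given by a node set \<open>V\<close> and a set \<open>E\<close> of two-element subsets of \<open>V\<close>, and \<open>S\<close> is a
  set of two-element subsets of \<open>V\<close>.  The space $\mathbb{R}^E$ is realised as the coordinate
  subspace of \<^typ>\<open>real ^ ('v set)\<close> of the vectors vanishing outside \<open>E\<close>.
\<close>

definition component :: "'v set \<Rightarrow> 'v set set \<Rightarrow> 'v \<Rightarrow> 'v set" where
  "component V E s = {t \<in> V. (s, t) \<in> {(u, w). u \<in> V \<and> w \<in> V \<and> {u, w} \<in> E}\<^sup>*}"

definition multicut :: "'v set \<Rightarrow> 'v set set \<Rightarrow> 'v set set \<Rightarrow> 'v set set \<Rightarrow> bool" where
  "multicut V E S \<delta> \<longleftrightarrow>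
     \<delta> \<subseteq> E \<and> (\<forall>s t. {s, t} \<in> S \<longrightarrow> component V (E - \<delta>) s \<noteq> component V (E - \<delta>) t)"

definition incidence_vector :: "'e set \<Rightarrow> real ^ 'e" where
  "incidence_vector F = (\<chi> e. if e \<in> F then 1 else 0)"

definition multicut_polytope ::
    "'v::finite set \<Rightarrow> 'v set set \<Rightarrow> 'v set set \<Rightarrow> (real ^ ('v set)) set" where
  "multicut_polytope V E S = convex hull (incidence_vector ` {\<delta>. multicut V E S \<delta>})"

definition nonneg_orthant :: "'e set \<Rightarrow> (real ^ 'e) set" where
  "nonneg_orthant E = {y. (\<forall>e\<in>E. 0 \<le> y $ e) \<and> (\<forall>e. e \<notin> E \<longrightarrow> y $ e = 0)}"

definition multicut_dominant ::
    "'v::finite set \<Rightarrow> 'v set set \<Rightarrow> 'v set set \<Rightarrow> (real ^ ('v set)) set" where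
  "multicut_dominant V E S =
     {x + y | x y. x \<in> multicut_polytope V E S \<and> y \<in> nonneg_orthant E}"

text \<open>The inequality $f(x) \ge b$ is facet-defining for \<open>P\<close>.\<close>

definition facet_defining ::
    "('a::euclidean_space \<Rightarrow> real) \<Rightarrow> real \<Rightarrow> 'a set \<Rightarrow> bool" where
  "facet_defining f b P \<longleftrightarrow>
     linear f \<and> (\<forall>x\<in>P. f x \<ge> b) \<and> {x \<in> P. f x = b} facet_of P"

definition defines_shared_facet ::
    "(real ^ ('v set) \<Rightarrow> real) \<Rightarrow> real \<Rightarrow> 'v::finite set \<Rightarrow> 'v set set \<Rightarrow> 'v set set \<Rightarrow> bool" where
  "defines_shared_facet f b V E S \<longleftrightarrow>
     facet_defining f b (multicut_dominant V E S) \<and>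
     facet_defining f b (multicut_polytope V E S)"

definition cycle_nodes :: "(nat \<Rightarrow> 'v) \<Rightarrow> nat \<Rightarrow> 'v set" where
  "cycle_nodes v m = v ` {..<m}"

text \<open>Integer edge indices, taken modulo the length \<open>m\<close>, so that the index $-1$ denotes edge $m-1$.\<close>

definition cycle_edge :: "(nat \<Rightarrow> 'v) \<Rightarrow> nat \<Rightarrow> int \<Rightarrow> 'v set" where
  "cycle_edge v m j = {v (nat (j mod int m)), v (nat ((j + 1) mod int m))}"

definition cycle_edges :: "(nat \<Rightarrow> 'v) \<Rightarrow> nat \<Rightarrow> 'v set set" where
  "cycle_edges v m = {cycle_edge v m j | j. 0 \<le> j \<and> j < int m}"

definition antipodal_pairs :: "(nat \<Rightarrow> 'v) \<Rightarrow> nat \<Rightarrow> 'v set set" where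
  "antipodal_pairs v n = {{v i, v ((i + n) mod (2 * n))} | i. 1 \<le> i \<and> i \<le> n}"

end

theory Submission
  imports Defs
begin

text \<open>
  An edge set of \<open>C\<^bsub>2n\<^esub>\<close> is a multicut iff it meets every window of \<open>n\<close> consecutive edges.  Hence it
  contains either two antipodal edges, which have weight \<open>1 + 2\<close> because \<open>n\<close> is odd, or at least
  three edges; this gives validity.  The tight multicuts are the antipodal pairs and the triples of
  edges of weight \<open>1\<close> with all gaps at most \<open>n\<close>.  The triples with gaps \<open>(n - 1, n - 1, 2)\<close> and
  \<open>(n - 1, n - 3, 4)\<close> starting at the same edge differ by exchanging two consecutive edges of
  weight \<open>1\<close>, so the tight incidence vectors span every unit vector of weight \<open>1\<close>, and with the
  antipodal pairs all of \<open>\<real>\<^sup>E\<close>.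
\<close>

section \<open>Facets certified by linearly spanning tight points\<close>

text \<open>The linear span of \<open>T\<close> is the affine hull of \<open>T\<close> with the
  origin added, so its dimension exceeds that of \<open>T\<close> by at most one. Hence
  \<open>F\<close> misses at most one dimension of \<open>P\<close>, and properness of the face
  makes it exactly one. Linear spanning thus replaces the search for affinely independent
  points.\<close>

lemma facet_of_if_spanning:
  fixes P :: "'a::euclidean_space set"
  assumes P: "convex P" and F: "F face_of P" "F \<noteq> P" "F \<noteq> {}" and T: "T \<subseteq> F" "P \<subseteq> span T"
  shows "F facet_of P"
proof -
  have "aff_dim P \<le> aff_dim (span T)"
    using T(2) by (rule aff_dim_subset)
  also have "\<dots> = aff_dim (insert 0 T)"
    by (simp add: aff_dim_subspace aff_dim_zero hull_inc) (metis dim_span span_insert_0)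
  also have "\<dots> \<le> aff_dim T + 1"
    by (simp add: aff_dim_insert)
  also have "\<dots> \<le> aff_dim F + 1"
    using aff_dim_subset[OF T(1)] by simp
  finally have "aff_dim P \<le> aff_dim F + 1" .
  moreover have "aff_dim F < aff_dim P"
    using face_of_aff_dim_lt[OF P F(1,2)] .
  ultimately show ?thesis
    using F by (auto simp: facet_of_def)
qed

lemma facet_defining_if_spanning:
  fixes f :: "'a::euclidean_space \<Rightarrow> real"
  assumes "linear f" "convex P" "\<And>x. x \<in> P \<Longrightarrow> b \<le> f x"
    and "T \<subseteq> P" "\<And>x. x \<in> T \<Longrightarrow> f x = b" "T \<noteq> {}" "P \<subseteq> span T"
    and "z \<in> P" "f z \<noteq> b"
  shows "facet_defining f b P"
proof -
  \<comment> \<open>The vector representing the functional \<open>f\<close>, since supporting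
    hyperplanes are stated with inner products.\<close>
  define a where "a = adjoint f 1"
  have f: "f x = a \<bullet> x" for x
    using adjoint_works[OF assms(1), of x 1] by (simp add: a_def inner_commute)
  have "P \<inter> {x. a \<bullet> x = b} face_of P"
    using assms(2,3) by (intro face_of_Int_supporting_hyperplane_ge) (auto simp: f)
  moreover have "P \<inter> {x. a \<bullet> x = b} = {x \<in> P. f x = b}"
    by (auto simp: f)
  ultimately have "{x \<in> P. f x = b} facet_of P"
    using assms by (intro facet_of_if_spanning[where T = T]) auto
  then show ?thesis
    using assms by (auto simp: facet_defining_def)
qed

section \<open>Incidence vectors, weights and the dominant of an arbitrary graph\<close>

lemma incidence_vector_eq_sum:
  "incidence_vector F = (\<Sum>e\<in>F. axis e 1)" for F :: "'e::finite set"
  by (simp add: vec_eq_iff incidence_vector_def axis_def sum.delta' if_distrib cong: if_cong)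

lemma vec_eq_sum_axis:
  fixes x :: "real ^ 'e::finite"
  assumes "\<And>e. e \<notin> E \<Longrightarrow> x $ e = 0"
  shows "x = (\<Sum>e\<in>E. x $ e *\<^sub>R axis e 1)"
  using assms by (auto simp: vec_eq_iff axis_def sum.delta' if_distrib cong: if_cong)

lemma linear_weight: "linear (\<lambda>x :: real ^ 'e. \<Sum>e\<in>E. c e * x $ e)"
  by (rule linearI) (simp_all add: algebra_simps sum.distrib sum_distrib_left)

lemma weight_incidence_vector:
  fixes E F :: "'e::finite set"
  assumes "F \<subseteq> E"
  shows "(\<Sum>e\<in>E. c e * incidence_vector F $ e) = sum c F"
proof -
  have "(\<Sum>e\<in>E. c e * incidence_vector F $ e) = (\<Sum>e\<in>E. if e \<in> F then c e else 0)"
    by (intro sum.cong) (auto simp: incidence_vector_def)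
  also have "\<dots> = sum c F"
    using assms by (subst sum.inter_restrict[symmetric]) (auto simp: Int_absorb1)
  finally show ?thesis .
qed

lemma convex_nonneg_orthant: "convex (nonneg_orthant E)"
  by (auto simp: convex_def nonneg_orthant_def)

lemma multicut_dominant_eq_sum_set:
  "multicut_dominant V E S = (\<Union>x\<in>multicut_polytope V E S. \<Union>y\<in>nonneg_orthant E. {x + y})"
  by (auto simp: multicut_dominant_def)

lemma convex_multicut_dominant: "convex (multicut_dominant V E S)"
  unfolding multicut_dominant_eq_sum_set
  by (intro convex_sums convex_nonneg_orthant) (simp add: multicut_polytope_def)

lemma polytope_subset_dominant: "multicut_polytope V E S \<subseteq> multicut_dominant V E S"
proof
  fix x assume "x \<in> multicut_polytope V E S"
  then show "x \<in> multicut_dominant V E S"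
    unfolding multicut_dominant_def
    by (intro CollectI exI[of _ x] exI[of _ 0]) (simp add: nonneg_orthant_def)
qed

lemma incidence_vector_in_polytope:
  "multicut V E S \<delta> \<Longrightarrow> incidence_vector \<delta> \<in> multicut_polytope V E S"
  unfolding multicut_polytope_def by (intro hull_inc) auto

text \<open>Both summands of the dominant consist of linear combinations of the unit vectors of
  edges. With \<open>U\<close> a span of tight vectors, this reduces spanning to reaching each such
  unit vector.\<close>

lemma multicut_dominant_subset_subspace:
  fixes V :: "'v::finite set" and U :: "(real ^ 'v set) set"
  assumes "subspace U" "\<And>e. e \<in> E \<Longrightarrow> axis e 1 \<in> U"
  shows "multicut_dominant V E S \<subseteq> U"
proof -
  have "multicut_polytope V E S \<subseteq> U"
    unfolding multicut_polytope_def
  proof (rule hull_minimal)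
    show "convex U"
      using assms(1) by (rule subspace_imp_convex)
    show "incidence_vector ` {\<delta>. multicut V E S \<delta>} \<subseteq> U"
      using assms by (auto simp: incidence_vector_eq_sum multicut_def intro!: subspace_sum)
  qed
  moreover have "nonneg_orthant E \<subseteq> U"
  proof
    fix y :: "real ^ 'v set" assume "y \<in> nonneg_orthant E"
    then have "y = (\<Sum>e\<in>E. y $ e *\<^sub>R axis e 1)"
      by (intro vec_eq_sum_axis) (auto simp: nonneg_orthant_def)
    moreover have "(\<Sum>e\<in>E. y $ e *\<^sub>R axis e 1) \<in> U"
      using assms by (intro subspace_sum subspace_scale)
    ultimately show "y \<in> U" by simp
  qed
  ultimately show ?thesis
    using assms(1) by (auto simp: multicut_dominant_def intro!: subspace_add)
qed

text \<open>The half-space is convex, so checking the multicuts themselves settles the polytope;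
  nonnegative weights then keep the bound under adding the orthant.\<close>

lemma dominant_weight_ge:
  fixes V :: "'v::finite set" and c :: "'v set \<Rightarrow> real"
  assumes "\<And>e. e \<in> E \<Longrightarrow> 0 \<le> c e" "\<And>\<delta>. multicut V E S \<delta> \<Longrightarrow> b \<le> sum c \<delta>"
    and "x \<in> multicut_dominant V E S"
  shows "b \<le> (\<Sum>e\<in>E. c e * x $ e)"
proof -
  define f where "f x = (\<Sum>e\<in>E. c e * x $ e)" for x :: "real ^ 'v set"
  have lin: "linear f"
    unfolding f_def by (rule linear_weight)
  have inc: "f (incidence_vector \<delta>) = sum c \<delta>" if "multicut V E S \<delta>" for \<delta>
    using that by (simp add: f_def weight_incidence_vector multicut_def)
  obtain y z where x: "x = y + z" "y \<in> multicut_polytope V E S" "z \<in> nonneg_orthant E"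
    using assms(3) by (auto simp: multicut_dominant_def)
  have "convex {y. b \<le> f y}"
    using convex_linear_vimage[OF lin convex_real_interval(1)[of b]]
    by (simp add: vimage_def)
  moreover have "incidence_vector ` {\<delta>. multicut V E S \<delta>} \<subseteq> {y. b \<le> f y}"
    using assms(2) inc by auto
  ultimately have "multicut_polytope V E S \<subseteq> {y. b \<le> f y}"
    unfolding multicut_polytope_def by (intro hull_minimal) auto
  then have "b \<le> f y" using x by auto
  moreover have "0 \<le> f z"
    unfolding f_def using assms(1) x(3) by (intro sum_nonneg) (auto simp: nonneg_orthant_def)
  ultimately show ?thesis
    using x(1) linear_add[OF lin, of y z] by (simp add: f_def)
qed

section \<open>Integer indexing of the nodes and edges of the cycle\<close>

locale antipodal_cycle =
  fixes n :: nat and v :: "nat \<Rightarrow> 'v::finite"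
  assumes n_ge_2: "2 \<le> n" and inj: "inj_on v {..<2 * n}"
begin

abbreviation "V \<equiv> cycle_nodes v (2 * n)"
abbreviation "E \<equiv> cycle_edges v (2 * n)"
abbreviation "S \<equiv> antipodal_pairs v n"
abbreviation "edge \<equiv> cycle_edge v (2 * n)"

text \<open>Periodic indexing by all integers lets arcs run past index 0 and makes the antipode a
  plain shift by \<open>n\<close>.\<close>

definition node :: "int \<Rightarrow> 'v" where
  "node j = v (nat (j mod (2 * int n)))"

lemma edge_eq: "edge j = {node j, node (j + 1)}"
  by (simp add: cycle_edge_def node_def)

lemma node_eq_iff: "node i = node j \<longleftrightarrow> 2 * int n dvd i - j"
proof -
  have *: "nat (k mod (2 * int n)) \<in> {..<2 * n}" for k
    using n_ge_2 by (simp add: nat_less_iff)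
  have "node i = node j \<longleftrightarrow> nat (i mod (2 * int n)) = nat (j mod (2 * int n))"
    unfolding node_def using inj_on_eq_iff[OF inj * *] .
  also have "\<dots> \<longleftrightarrow> i mod (2 * int n) = j mod (2 * int n)"
    using n_ge_2 by (intro eq_nat_nat_iff) simp_all
  finally show ?thesis
    by (simp add: mod_eq_dvd_iff)
qed

lemma edge_eq_iff: "edge i = edge j \<longleftrightarrow> 2 * int n dvd i - j"
proof
  assume "edge i = edge j"
  then consider "node i = node j" | "node i = node (j + 1)" "node (i + 1) = node j"
    by (auto simp: edge_eq doubleton_eq_iff)
  then show "2 * int n dvd i - j"
  proof cases
    \<comment> \<open>Matching the endpoints in reverse would make 2 divisible by
      \<open>2 * n\<close>, which \<open>n_ge_2\<close> excludes.\<close>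
    case 2
    then have "2 * int n dvd (i + 1 - j) - (i - (j + 1))"
      unfolding node_eq_iff by (metis dvd_diff)
    then have "2 * int n dvd 2" by simp
    then have "2 * int n \<le> 2" by (rule zdvd_imp_le) simp
    then show ?thesis using n_ge_2 by simp
  qed (simp add: node_eq_iff)
next
  assume "2 * int n dvd i - j"
  then have "node i = node j" "node (i + 1) = node (j + 1)"
    by (simp_all add: node_eq_iff)
  then show "edge i = edge j" by (simp add: edge_eq)
qed

lemma not_dvd_small: "0 < \<bar>k\<bar> \<Longrightarrow> \<bar>k\<bar> < 2 * int n \<Longrightarrow> \<not> 2 * int n dvd k" for k
  using zdvd_not_zless[of "\<bar>k\<bar>" "2 * int n"] by simp

lemma edge_add_period: "edge (j + 2 * int n * q) = edge j"
  by (simp add: edge_eq_iff)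

text \<open>The base \<open>a\<close> is free, so each argument can cut the cycle open where it is
  convenient.\<close>

lemma representative:
  obtains r q where "j = r + 2 * int n * q" "a \<le> r" "r < a + 2 * int n"
proof
  show "j = (a + (j - a) mod (2 * int n)) + 2 * int n * ((j - a) div (2 * int n))"
    by simp
qed (use n_ge_2 in simp_all)

lemma cycle_nodes_eq: "V = range node"
proof -
  have "v i = node (int i)" if "i < 2 * n" for i
    using that by (simp add: node_def nat_mod_distrib)
  then have "V \<subseteq> range node" by (auto simp: cycle_nodes_def)
  moreover have "node j \<in> V" for j
    using n_ge_2 by (auto simp: cycle_nodes_def node_def nat_less_iff intro!: imageI)
  ultimately show ?thesis by auto
qed

lemma cycle_edges_eq: "E = range edge"
proof -
  have "edge j \<in> E" for j
  proof -
    obtain r q where "j = r + 2 * int n * q" "0 \<le> r" "r < 0 + 2 * int n"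
      by (rule representative)
    then show ?thesis
      by (auto simp: cycle_edges_def edge_add_period intro!: exI[of _ r])
  qed
  then show ?thesis by (auto simp: cycle_edges_def)
qed

lemma cycle_edges_eq_window: "E = edge ` {a..<a + 2 * int n}"
proof -
  have "edge j \<in> edge ` {a..<a + 2 * int n}" for j
    by (rule representative[of j a]) (auto simp: edge_add_period)
  then show ?thesis by (auto simp: cycle_edges_eq)
qed

lemma inj_on_edge: "inj_on edge {a..<a + 2 * int n}"
proof (rule inj_onI)
  fix i j assume "i \<in> {a..<a + 2 * int n}" "j \<in> {a..<a + 2 * int n}" "edge i = edge j"
  then show "i = j"
    using not_dvd_small[of "i - j"] by (force simp: edge_eq_iff)
qed

lemma edge_distinct:
  assumes "a < b" "b < c" "c < a + 2 * int n"
  shows "edge a \<noteq> edge b" "edge a \<noteq> edge c" "edge b \<noteq> edge c"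
  using assms by (auto dest!: inj_onD[OF inj_on_edge[of a]])

lemma antipodal_pairs_eq: "S = range (\<lambda>i. {node i, node (i + int n)})"
proof (intro equalityI subsetI)
  fix p assume "p \<in> S"
  then obtain i where i: "1 \<le> i" "i \<le> n" "p = {v i, v ((i + n) mod (2 * n))}"
    by (auto simp: antipodal_pairs_def)
  have "v i = node (int i)"
    using i n_ge_2 by (simp add: node_def nat_mod_distrib)
  moreover have "v ((i + n) mod (2 * n)) = node (int i + int n)"
    by (simp add: node_def nat_mod_distrib nat_add_distrib nat_mult_distrib)
  ultimately show "p \<in> range (\<lambda>i. {node i, node (i + int n)})"
    using i by auto
next
  have *: "{node i, node (i + int n)} \<in> S" if "1 \<le> i" "i \<le> int n" for i
  proof -
    have "node i = v (nat i)"
      using that n_ge_2 by (simp add: node_def)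
    moreover have "node (i + int n) = v ((nat i + n) mod (2 * n))"
      using that by (simp add: node_def nat_mod_distrib nat_add_distrib nat_mult_distrib)
    ultimately show ?thesis
      using that unfolding antipodal_pairs_def by (auto intro!: exI[of _ "nat i"])
  qed
  fix p assume "p \<in> range (\<lambda>i. {node i, node (i + int n)})"
  then obtain i where p: "p = {node i, node (i + int n)}" by auto
  obtain r q where r: "i = r + 2 * int n * q" "1 \<le> r" "r < 1 + 2 * int n"
    by (rule representative)
  show "p \<in> S"
  proof (cases "r \<le> int n")
    case True
    have "node i = node r" "node (i + int n) = node (r + int n)"
      unfolding node_eq_iff r(1) by simp_all
    then show ?thesis using * True r by (simp add: p)
  next
    \<comment> \<open>For \<open>r > n\<close> the index \<open>r - n\<close> gives the same
      unordered pair with its nodes swapped.\<close>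
    case False
    have "node i = node ((r - int n) + int n)"
      unfolding node_eq_iff r(1) by simp
    moreover have "i + int n - (r - int n) = 2 * int n * (q + 1)"
      unfolding r(1) by (simp add: algebra_simps)
    then have "node (i + int n) = node (r - int n)"
      unfolding node_eq_iff by simp
    ultimately show ?thesis
      using *[of "r - int n"] False r by (simp add: p insert_commute)
  qed
qed

section \<open>Multicuts of the cycle as edge sets meeting every window\<close>

lemma path_in_component:
  assumes "edge ` {i..<i + int k} \<subseteq> F"
  shows "(node i, node (i + int k)) \<in> {(u, w). u \<in> V \<and> w \<in> V \<and> {u, w} \<in> F}\<^sup>*"
  using assms
proof (induction k)
  case (Suc k)
  have "edge (i + int k) \<in> F" using Suc.prems by auto
  moreover have "i + int (Suc k) = i + int k + 1" by simp
  ultimately have "(node (i + int k), node (i + int (Suc k))) \<in> {(u, w). u \<in> V \<and> w \<in> V \<and> {u, w} \<in> F}"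
    by (simp only: edge_eq) (simp add: cycle_nodes_eq)
  moreover have "edge ` {i..<i + int k} \<subseteq> F" using Suc.prems by auto
  ultimately show ?case using Suc.IH by (meson rtrancl.rtrancl_into_rtrancl)
qed simp

text \<open>Only \<open>edge a\<close> and \<open>edge b\<close> leave the arc of nodes
  \<open>a + 1, ..., b\<close>, and both are cut, so membership in the arc is invariant along any
  path.\<close>

lemma arc_not_reachable:
  assumes ab: "a < b" "b < a + 2 * int n" and cut: "edge a \<in> \<delta>" "edge b \<in> \<delta>"
    and reach: "(x, y) \<in> {(u, w). u \<in> V \<and> w \<in> V \<and> {u, w} \<in> E - \<delta>}\<^sup>*"
    and x: "x \<in> node ` {a<..b}"
  shows "y \<in> node ` {a<..b}"
  using reach x
proof (induction rule: rtrancl_induct)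
  case (step u w)
  then have u: "u \<in> node ` {a<..b}" and uw: "{u, w} \<in> E" "{u, w} \<notin> \<delta>" by auto
  from uw(1) obtain k where k: "{u, w} = edge k" "k \<in> {a..<a + 2 * int n}"
    unfolding cycle_edges_eq_window[of a] by blast
  have "k \<noteq> a" "k \<noteq> b" using k uw cut by auto
  \<comment> \<open>These indices run through the complementary arc; they differ from those of the
    arc by less than one period. An edge with index beyond \<open>b\<close> has both ends
    there.\<close>
  have not_in: "node l \<notin> node ` {a<..b}" if "b < l" "l \<le> a + 2 * int n" for l
  proof
    assume "node l \<in> node ` {a<..b}"
    then obtain l' where "2 * int n dvd l - l'" "a < l'" "l' \<le> b"
      by (auto simp: node_eq_iff)
    then show False using not_dvd_small[of "l - l'"] that by linarith
  qed
  have "k < b"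
  proof (rule ccontr)
    assume "\<not> k < b"
    then have "node k \<notin> node ` {a<..b}" "node (k + 1) \<notin> node ` {a<..b}"
      using k \<open>k \<noteq> b\<close> by (intro not_in; simp)+
    moreover have "u = node k \<or> u = node (k + 1)"
      using k(1) by (auto simp: edge_eq doubleton_eq_iff)
    ultimately show False using u by metis
  qed
  then have "node k \<in> node ` {a<..b}" "node (k + 1) \<in> node ` {a<..b}"
    using k \<open>k \<noteq> a\<close> by auto
  then show ?case using k(1) by (auto simp: edge_eq doubleton_eq_iff)
qed

text \<open>A window of \<open>n\<close> consecutive edges is one of the two paths between antipodal
  nodes: if uncut, it joins them. Conversely, one cut edge on each of the two paths separates
  them.\<close>

lemma multicut_iff:
  "multicut V E S \<delta> \<longleftrightarrow> \<delta> \<subseteq> E \<and> (\<forall>i. \<exists>k. i \<le> k \<and> k < i + int n \<and> edge k \<in> \<delta>)"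
proof (intro iffI conjI allI)
  assume cut: "multicut V E S \<delta>"
  then show "\<delta> \<subseteq> E" by (simp add: multicut_def)
  fix i
  show "\<exists>k. i \<le> k \<and> k < i + int n \<and> edge k \<in> \<delta>"
  proof (rule ccontr)
    let ?R = "{(u, w). u \<in> V \<and> w \<in> V \<and> {u, w} \<in> E - \<delta>}"
    assume "\<not> ?thesis"
    then have "edge ` {i..<i + int n} \<subseteq> E - \<delta>" by (auto simp: cycle_edges_eq)
    then have "(node i, node (i + int n)) \<in> ?R\<^sup>*" by (rule path_in_component)
    moreover have "sym (?R\<^sup>*)"
      by (intro sym_rtrancl) (auto simp: sym_def insert_commute)
    ultimately have "(node i, t) \<in> ?R\<^sup>* \<longleftrightarrow> (node (i + int n), t) \<in> ?R\<^sup>*" for t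
      by (meson rtrancl_trans symD)
    then have "component V (E - \<delta>) (node i) = component V (E - \<delta>) (node (i + int n))"
      by (simp add: component_def)
    moreover have "{node i, node (i + int n)} \<in> S" by (auto simp: antipodal_pairs_eq)
    ultimately show False using cut by (auto simp: multicut_def)
  qed
next
  assume \<delta>: "\<delta> \<subseteq> E \<and> (\<forall>i. \<exists>k. i \<le> k \<and> k < i + int n \<and> edge k \<in> \<delta>)"
  have sep: "component V (E - \<delta>) (node i) \<noteq> component V (E - \<delta>) (node (i + int n))" for i
  proof
    assume eq: "component V (E - \<delta>) (node i) = component V (E - \<delta>) (node (i + int n))"
    have "node i \<in> component V (E - \<delta>) (node i)"
      by (simp add: component_def cycle_nodes_eq)
    then have reach: "(node (i + int n), node i) \<in> {(u, w). u \<in> V \<and> w \<in> V \<and> {u, w} \<in> E - \<delta>}\<^sup>*"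
      unfolding eq by (simp add: component_def)
    \<comment> \<open>The arc from \<open>a + 1\<close> to \<open>b\<close> contains
      \<open>node (i + int n)\<close> but not \<open>node i\<close>.\<close>
    obtain a b where ab: "i \<le> a" "a < i + int n" "edge a \<in> \<delta>"
      "i + int n \<le> b" "b < i + int n + int n" "edge b \<in> \<delta>"
      using \<delta> by meson
    have "node i \<in> node ` {a<..b}"
      using ab by (intro arc_not_reachable[OF _ _ _ _ reach]) auto
    then obtain l where "2 * int n dvd i - l" "a < l" "l \<le> b"
      by (auto simp: node_eq_iff)
    then show False using not_dvd_small[of "i - l"] ab by linarith
  qed
  show "multicut V E S \<delta>"
    unfolding multicut_def
  proof (intro conjI allI impI)
    fix s t assume "{s, t} \<in> S"
    then obtain i where "{s, t} = {node i, node (i + int n)}"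
      unfolding antipodal_pairs_eq by blast
    then show "component V (E - \<delta>) s \<noteq> component V (E - \<delta>) t"
      using sep[of i] by (auto simp: doubleton_eq_iff)
  qed (use \<delta> in simp)
qed

text \<open>The hypotheses say that the three cyclic gaps are at most \<open>n\<close>. The weak
  inequalities admit \<open>b = c\<close>, which covers antipodal pairs.\<close>

lemma multicut_triple:
  assumes "a \<le> b" "b \<le> a + int n" "b \<le> c" "c \<le> b + int n" "c \<le> a + 2 * int n" "a + int n \<le> c"
  shows "multicut V E S {edge a, edge b, edge c}"
  unfolding multicut_iff
proof (intro conjI allI)
  fix i
  obtain r q where r: "i = r + 2 * int n * q" "a \<le> r" "r < a + 2 * int n"
    by (rule representative)
  have period: "edge (a + 2 * int n) = edge a" by (simp add: edge_eq_iff)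
  \<comment> \<open>The first listed position at or after \<open>r\<close> works: it is
    \<open>r\<close> itself or ends a gap in which \<open>r\<close> lies strictly inside. The
    position \<open>a + 2 * int n\<close> is \<open>edge a\<close> one turn later.\<close>
  have "\<exists>k\<in>{a, b, c, a + 2 * int n}. r \<le> k \<and> k < r + int n"
    using assms r(2,3) n_ge_2 by auto
  then obtain k where "r \<le> k" "k < r + int n" "edge k \<in> {edge a, edge b, edge c}"
    using period by auto
  then show "\<exists>k. i \<le> k \<and> k < i + int n \<and> edge k \<in> {edge a, edge b, edge c}"
    by (intro exI[of _ "k + 2 * int n * q"]) (simp add: r(1) edge_add_period)
qed (auto simp: cycle_edges_eq)

lemma multicut_antipodal: "multicut V E S {edge a, edge (a + int n)}"
  using multicut_triple[of a "a + int n" "a + int n"] by simp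

text \<open>From a cut edge \<open>k0\<close>, take cut edges in the windows starting at
  \<open>k0 + 1\<close> and \<open>k0 + n\<close>. The windows share only the index
  \<open>k0 + n\<close>, so either both choices are the antipode or there are three distinct
  edges.\<close>

lemma multicut_cases:
  assumes "multicut V E S \<delta>"
  obtains k where "{edge k, edge (k + int n)} \<subseteq> \<delta>" | "3 \<le> card \<delta>"
proof -
  have hit: "\<exists>k. i \<le> k \<and> k < i + int n \<and> edge k \<in> \<delta>" for i
    using assms by (simp add: multicut_iff)
  obtain k0 where k0: "edge k0 \<in> \<delta>" using hit by blast
  obtain k1 where k1: "k0 + 1 \<le> k1" "k1 < k0 + 1 + int n" "edge k1 \<in> \<delta>" using hit by blast
  obtain k2 where k2: "k0 + int n \<le> k2" "k2 < k0 + int n + int n" "edge k2 \<in> \<delta>" using hit by blast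
  show ?thesis
  proof (cases "k1 = k2")
    case True
    then have "k1 = k0 + int n" using k1 k2 by linarith
    then show ?thesis using that(1)[of k0] k0 k1 by simp
  next
    case False
    have "edge ` {k0, k1, k2} \<subseteq> \<delta>" using k0 k1 k2 by simp
    then have "card (edge ` {k0, k1, k2}) \<le> card \<delta>" by (intro card_mono) auto
    moreover have "inj_on edge {k0, k1, k2}"
      using k1 k2 by (intro inj_on_subset[OF inj_on_edge[of k0]]) auto
    then have "card (edge ` {k0, k1, k2}) = card {k0, k1, k2}" by (rule card_image)
    ultimately show ?thesis using that(2) False k1 k2 by (simp add: card_insert_if)
  qed
qed

section \<open>Unit vectors in the span of the tight multicuts\<close>

text \<open>The predicate \<open>light\<close> marks the indices of coefficient 1. Only its
  alternation is used, so both values of \<open>\<beta>\<close> are treated at once.\<close>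

lemma axis_in_span_tight:
  fixes T :: "(real ^ 'v set) set" and light :: "int \<Rightarrow> bool"
  assumes n: "5 \<le> n" "odd n"
    and light: "\<And>j. light (j + 1) \<longleftrightarrow> \<not> light j"
    and pair: "\<And>j. incidence_vector {edge j, edge (j + int n)} \<in> span T"
    and triple: "\<And>a b c. light a \<Longrightarrow> light b \<Longrightarrow> light c \<Longrightarrow> a < b \<Longrightarrow> b < c \<Longrightarrow> c < a + 2 * int n \<Longrightarrow>
       multicut V E S {edge a, edge b, edge c} \<Longrightarrow> incidence_vector {edge a, edge b, edge c} \<in> span T"
  shows "axis (edge j) 1 \<in> span T"
proof -
  define A :: "int \<Rightarrow> real ^ 'v set" where "A j = axis (edge j) 1" for j
  have A_cong: "A i = A j" if "2 * int n dvd i - j" for i j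
    using that by (simp add: A_def flip: edge_eq_iff)
  have light_2: "light (j + 2) \<longleftrightarrow> light j" for j
    using light[of j] light[of "j + 1"] by (simp add: add.assoc)
  have light_even: "light (j + 2 * int k) \<longleftrightarrow> light j" for j k
    by (induction k) (use light_2[of "j + 2 * int k" for k] in \<open>simp_all add: algebra_simps\<close>)
  obtain m where m: "n = 2 * m + 1" using n(2) by (rule oddE)
  have m2: "2 \<le> m" using n m by simp
  have pair': "A j + A (j + int n) \<in> span T" for j
    using pair[of j] n_ge_2 not_dvd_small[of "int n"]
    by (simp add: incidence_vector_eq_sum A_def edge_eq_iff)
  have inc3: "incidence_vector {edge a, edge b, edge c} = A a + A b + A c"
    if "a < b" "b < c" "c < a + 2 * int n" for a b c
    using edge_distinct[OF that] by (simp add: incidence_vector_eq_sum A_def add.assoc)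
  have triple': "A a + A b + A c \<in> span T"
    if "light a" "light b" "light c" "a < b" "b < c" "c < a + 2 * int n"
      "b \<le> a + int n" "c \<le> b + int n" "a + int n \<le> c" for a b c
    using triple[of a b c] multicut_triple[of a b c] inc3[of a b c] that by simp
  \<comment> \<open>With \<open>n = 2 * m + 1\<close> the gaps are \<open>2 * m\<close>,
    \<open>2 * m\<close> and 2.\<close>
  have t1: "A j + A (j + 2 * int m) + A (j + 4 * int m) \<in> span T" if "light j" for j
    using that m m2 light_even[of j m] light_even[of j "2 * m"] by (intro triple') simp_all
  \<comment> \<open>The gaps are \<open>2 * m\<close>, \<open>2 * m - 2\<close> and 4; the last is
    at most \<open>n\<close> because \<open>n \<ge> 5\<close>.\<close>
  have t2: "A j + A (j + 2 * int m) + A (j + 4 * int m - 2) \<in> span T" if "light j" for j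
  proof (rule triple')
    have "j + 2 * int (2 * m - 1) = j + 4 * int m - 2" using m2 by (simp add: of_nat_diff)
    then show "light (j + 4 * int m - 2)" using that light_even by metis
  qed (use that m m2 light_even[of j m] in simp_all)
  have step: "A (j + 2) - A j \<in> span T" if "light j" for j
  proof -
    \<comment> \<open>Starting at \<open>j + 4\<close> makes the exchanged edges
      \<open>j + 2\<close> and \<open>j\<close> after one full turn, as
      \<open>4 * m + 4 = 2 * n + 2\<close>.\<close>
    have l: "light (j + 4)" using that light_even[of j 2] by simp
    have "A (j + 4 + 4 * int m) - A (j + 4 + 4 * int m - 2) \<in> span T"
      using span_diff[OF t1[OF l] t2[OF l]] by simp
    moreover have "A (j + 4 + 4 * int m) = A (j + 2)" "A (j + 4 + 4 * int m - 2) = A j"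
      by (rule A_cong, simp add: m)+
    ultimately show ?thesis by simp
  qed
  have steps: "A (j + 2 * int k) - A j \<in> span T" if "light j" for j k
  proof (induction k)
    case (Suc k)
    have "light (j + 2 * int k)" using that light_even by simp
    from span_add[OF step[OF this] Suc] show ?case by (simp add: algebra_simps)
  qed (simp add: span_0)
  have light_in: "A j \<in> span T" if "light j" for j
  proof -
    \<comment> \<open>Modulo the span all light unit vectors agree, so a tight triple amounts to
      \<open>3 *\<^sub>R A j\<close>.\<close>
    have "(A j + A (j + 2 * int m) + A (j + 4 * int m)) - (A (j + 2 * int m) - A j)
        - (A (j + 2 * int (2 * m)) - A j) \<in> span T"
      using that by (intro span_diff t1 steps)
    moreover have "(A j + A (j + 2 * int m) + A (j + 4 * int m)) - (A (j + 2 * int m) - A j)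
        - (A (j + 2 * int (2 * m)) - A j) = 3 *\<^sub>R A j"
      by (simp add: vec_eq_iff)
    ultimately have "(1/3) *\<^sub>R 3 *\<^sub>R A j \<in> span T" by (metis span_scale)
    then show ?thesis by simp
  qed
  have "A j \<in> span T"
  proof (cases "light j")
    case False
    \<comment> \<open>As \<open>n\<close> is odd, the antipode of a heavy edge is light, and the
      antipodal pair yields the heavy unit vector.\<close>
    then have "light (j + int n)"
      using light_even[of "j + 1" m] light[of j] by (simp add: m algebra_simps)
    from span_diff[OF pair'[of j] light_in[OF this]] show ?thesis by simp
  qed (rule light_in)
  then show ?thesis by (simp add: A_def)
qed

end

section \<open>Validity, tight multicuts and the two facets\<close>

theorem theorem7p3:
  fixes n :: nat and v :: "nat \<Rightarrow> 'v::finite" and \<beta> \<beta>' :: real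
  assumes "n \<ge> 5" and "odd n"
    and "inj_on v {..<2 * n}"
    and "\<beta> \<in> {1, 2}" and "\<beta>' = 3 - \<beta>"
  shows "defines_shared_facet
           (\<lambda>x. \<Sum>i = 0..n - 1. \<beta> * x $ cycle_edge v (2 * n) (2 * int i - 1)
                              + \<beta>' * x $ cycle_edge v (2 * n) (2 * int i))
           3
           (cycle_nodes v (2 * n)) (cycle_edges v (2 * n)) (antipodal_pairs v n)"
proof -
  interpret antipodal_cycle n v
    using assms by unfold_locales auto
  define c where "c e = (if \<exists>j. odd j \<and> e = edge j then \<beta> else \<beta>')" for e
  \<comment> \<open>The cycle has even length, so an edge determines the parity of its
    indices.\<close>
  have c_edge: "c (edge j) = (if odd j then \<beta> else \<beta>')" for j
  proof -
    have "odd i \<longleftrightarrow> odd j" if "edge j = edge i" for i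
    proof -
      have "2 * int n dvd j - i" using that by (simp add: edge_eq_iff)
      then have "2 dvd j - i" by (rule dvd_mult_left)
      then show ?thesis by presburger
    qed
    then have "(\<exists>i. odd i \<and> edge j = edge i) \<longleftrightarrow> odd j" by blast
    then show ?thesis by (simp only: c_def)
  qed
  have c_ge: "1 \<le> c e" for e
    using assms(4,5) by (auto simp: c_def)
  have c_pair: "c (edge j) + c (edge (j + int n)) = 3" for j
    using assms(2,5) by (simp add: c_edge)
  have edge_pair_neq: "edge j \<noteq> edge (j + int n)" for j
    using not_dvd_small[of "int n"] assms(1) by (simp add: edge_eq_iff)
  define f where "f x = (\<Sum>e\<in>E. c e * x $ e)" for x :: "real ^ 'v set"
  have f_eq: "(\<lambda>x. \<Sum>i = 0..n - 1. \<beta> * x $ edge (2 * int i - 1) + \<beta>' * x $ edge (2 * int i)) = f"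
  proof
    fix x :: "real ^ 'v set"
    let ?g = "\<lambda>j. c (edge j) * x $ edge j"
    \<comment> \<open>The period starts at -1 because the pairs \<open>2 * i - 1, 2 * i\<close> for
      \<open>i = 0, ..., n - 1\<close> tile exactly this window.\<close>
    have "f x = sum ?g {-1..<-1 + 2 * int n}"
      unfolding f_def cycle_edges_eq_window[of "-1"] by (subst sum.reindex[OF inj_on_edge]) simp
    also have "{-1..<-1 + 2 * int n} = (\<Union>i\<in>{0..n - 1}. {2 * int i - 1, 2 * int i})"
    proof (intro equalityI subsetI)
      fix j assume "j \<in> {-1..<-1 + 2 * int n}"
      then have "nat ((j + 1) div 2) \<in> {0..n - 1}"
        "j \<in> {2 * int (nat ((j + 1) div 2)) - 1, 2 * int (nat ((j + 1) div 2))}"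
        using assms(1) by auto
      then show "j \<in> (\<Union>i\<in>{0..n - 1}. {2 * int i - 1, 2 * int i})" by blast
    qed (use assms(1) in auto)
    also have "sum ?g \<dots> = (\<Sum>i = 0..n - 1. sum ?g {2 * int i - 1, 2 * int i})"
      by (intro sum.UNION_disjoint) auto
    also have "\<dots> = (\<Sum>i = 0..n - 1. \<beta> * x $ edge (2 * int i - 1) + \<beta>' * x $ edge (2 * int i))"
      by (simp add: c_edge)
    finally show "(\<Sum>i = 0..n - 1. \<beta> * x $ edge (2 * int i - 1) + \<beta>' * x $ edge (2 * int i)) = f x"
      by simp
  qed
  have lin: "linear f"
    unfolding f_def by (rule linear_weight)
  have f_inc: "f (incidence_vector \<delta>) = sum c \<delta>" if "multicut V E S \<delta>" for \<delta>
    using that by (simp add: f_def weight_incidence_vector multicut_def)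
  have valid: "3 \<le> sum c \<delta>" if "multicut V E S \<delta>" for \<delta>
  proof (rule multicut_cases[OF that])
    fix k assume "{edge k, edge (k + int n)} \<subseteq> \<delta>"
    then have "sum c {edge k, edge (k + int n)} \<le> sum c \<delta>"
      using c_ge by (intro sum_mono2) (auto intro: order_trans[OF zero_le_one])
    then show ?thesis using c_pair[of k] edge_pair_neq[of k] by simp
  next
    assume "3 \<le> card \<delta>"
    then show ?thesis using sum_bounded_below[of \<delta> 1 c] c_ge by simp
  qed
  define T where "T = incidence_vector ` {\<delta>. multicut V E S \<delta> \<and> sum c \<delta> = 3}"
  have T_pair: "incidence_vector {edge j, edge (j + int n)} \<in> T" for j
    using multicut_antipodal[of j] c_pair[of j] edge_pair_neq[of j] by (simp add: T_def)
  have axis_T: "axis e 1 \<in> span T" if "e \<in> E" for e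
  proof -
    from that obtain j where "e = edge j" by (auto simp: cycle_edges_eq)
    moreover have "axis (edge j) 1 \<in> span T"
    \<comment> \<open>The light edges are the odd ones for \<open>\<beta> = 1\<close> and the even
      ones for \<open>\<beta> = 2\<close>.\<close>
    proof (rule axis_in_span_tight[where light = "\<lambda>j. odd j = (\<beta> = 1)"])
      fix a b d assume light: "odd a = (\<beta> = 1)" "odd b = (\<beta> = 1)" "odd d = (\<beta> = 1)"
        and lt: "a < b" "b < d" "d < a + 2 * int n"
        and cut: "multicut V E S {edge a, edge b, edge d}"
      note edge_distinct[OF lt]
      moreover have "c (edge a) = 1" "c (edge b) = 1" "c (edge d) = 1"
        using light assms(4,5) by (auto simp: c_edge)
      ultimately have "sum c {edge a, edge b, edge d} = 3" by simp
      then show "incidence_vector {edge a, edge b, edge d} \<in> span T"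
        using cut by (auto simp: T_def intro!: span_base)
    qed (use assms(1,2) T_pair in \<open>auto intro: span_base\<close>)
    ultimately show ?thesis by simp
  qed
  have D_sub: "multicut_dominant V E S \<subseteq> span T"
    by (rule multicut_dominant_subset_subspace) (auto intro: axis_T)
  have T_sub: "T \<subseteq> multicut_polytope V E S"
    by (auto simp: T_def intro: incidence_vector_in_polytope)
  have T_tight: "f x = 3" if "x \<in> T" for x
    using that f_inc by (auto simp: T_def)
  have f_ge: "3 \<le> f x" if "x \<in> multicut_dominant V E S" for x
    unfolding f_def
    by (rule dominant_weight_ge[OF _ valid that]) (auto intro: order_trans[OF zero_le_one c_ge])
  \<comment> \<open>The full edge set has weight at least \<open>2 * n > 3\<close>; it is the point
    off the hyperplane that makes the faces proper.\<close>
  have "multicut V E S E"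
    unfolding multicut_iff using assms(1) by (auto simp: cycle_edges_eq intro: exI[of _ i for i])
  moreover have "card E = 2 * n"
    unfolding cycle_edges_eq_window[of 0] card_image[OF inj_on_edge] by simp
  then have "sum c E > 3"
    using sum_bounded_below[of E 1 c] c_ge assms(1) by simp
  ultimately have z: "incidence_vector E \<in> multicut_polytope V E S" "f (incidence_vector E) \<noteq> 3"
    using f_inc by (auto intro: incidence_vector_in_polytope)
  have "T \<noteq> {}" using T_pair by blast
  \<comment> \<open>One certificate serves both sets: \<open>T\<close> and \<open>z\<close> lie in
    the smaller one, the polytope, while validity and containment in \<open>span T\<close> hold on
    the larger one, the dominant.\<close>
  note facet = facet_defining_if_spanning[OF lin, where T = T and b = 3 and z = "incidence_vector E"]
  have "facet_defining f 3 (multicut_dominant V E S)"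
    using convex_multicut_dominant f_ge T_sub T_tight \<open>T \<noteq> {}\<close> D_sub z polytope_subset_dominant
    by (intro facet) blast+
  moreover have "facet_defining f 3 (multicut_polytope V E S)"
  proof (rule facet)
    show "convex (multicut_polytope V E S)" by (simp add: multicut_polytope_def)
  qed (use f_ge T_sub T_tight \<open>T \<noteq> {}\<close> D_sub z polytope_subset_dominant in blast)+
  ultimately show ?thesis
    unfolding defines_shared_facet_def f_eq by simp
qed

end
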